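(* Let $d\ge2$, let $\mathcal{A}\subseteq\mathbb{R}^m$ be open, and suppose that the mapping $(\alpha,x)\mapsto\varphi_\alpha(x)\in\mathbb{R}$ is jointly $C^2$ on $\mathcal{A}\times\mathbb{R}^d$. Let $K\subset U\subseteq\mathbb{R}^d$, where $K$ is compact and $U$ is open. Fix $\boldsymbol{\alpha}^0=(\alpha_1^0,\ldots,\alpha_d^0)\in\mathcal{A}^d$. If $\mathsf{H}_{\boldsymbol{\alpha}^0}$ is fold non-degenerate at every critical point in $\overline{U}$, then the following hold simultaneously. (1) There exists an open neighbourhood $\boldsymbol{\alpha}^0\in\mathcal{V}\subseteq\mathcal{A}^d$ such that, for every $\boldsymbol{\beta}\in\mathcal{V}$, the encoding map $\mathsf{H}_{\boldsymbol{\beta}}$ is fold non-degenerate at every critical point in $K$. (2) Consequently, there exists an open set $W$ with $K\subset W\Subset U$ such that, for every $\boldsymbol{\beta}\in\mathcal{V}$, the family $\{\varphi_{\beta_1}|_W,\ldots,\varphi_{\beta_d}|_W\}$ satisfies the critical-hypersurface and tangential-immersion conditions on $W$.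
   Context: $W\Subset U$ means that $\overline{W}$ is compact and contained in $U$. For $\boldsymbol{\alpha}=(\alpha_1,\ldots,\alpha_d)\in\mathcal{A}^d$ the encoding map is $\mathsf{H}_{\boldsymbol{\alpha}}(x)=(\varphi_{\alpha_1}(x),\ldots,\varphi_{\alpha_d}(x))$, with spatial derivative $D_x\mathsf{H}_{\boldsymbol{\alpha}}(x)$; $J_{\boldsymbol{\alpha}}(x)=\det D_x\mathsf{H}_{\boldsymbol{\alpha}}(x)$; critical points are the points of $\Sigma_{\boldsymbol{\alpha}}=\{x\in\mathbb{R}^d:\operatorname{rank}D_x\mathsf{H}_{\boldsymbol{\alpha}}(x)\leq d-1\}$. The map $\mathsf{H}_{\boldsymbol{\alpha}}$ is fold non-degenerate at a critical point $x$ if $\operatorname{rank}D_x\mathsf{H}_{\boldsymbol{\alpha}}(x)=d-1$ and $D_xJ_{\boldsymbol{\alpha}}(x)[v]\neq0$ for every $v\in\ker D_x\mathsf{H}_{\boldsymbol{\alpha}}(x)\setminus\{0\}$. The critical-hypersurface and tangential-immersion conditions on an open set $W$ mean: there is a $C^1$ embedded $(d-1)$-dimensional submanifold $M\subseteq W$ (possibly empty) with $\Sigma_{\boldsymbol{\beta}}\cap W\subseteq M$ and $\operatorname{rank}(D_x\mathsf{H}_{\boldsymbol{\beta}}(x)|_{T_xM})=d-1$ for every $x\in M$. *)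

theory Defs
  imports "HOL-Analysis.Analysis"
begin

text \<open>Classes $C^1$ and $C^2$; both predicates are meant for open \<open>S\<close>, where the
  derivative is the full Frechet derivative and its continuity is with respect to the
  operator norm.\<close>

definition C1_on :: "('a::real_normed_vector \<Rightarrow> 'b::real_normed_vector) \<Rightarrow> 'a set \<Rightarrow> bool"
  where "C1_on f S \<longleftrightarrow>
    (\<exists>f' :: 'a \<Rightarrow> 'a \<Rightarrow>\<^sub>L 'b.
       (\<forall>x\<in>S. (f has_derivative blinfun_apply (f' x)) (at x)) \<and> continuous_on S f')"

definition C2_on :: "('a::real_normed_vector \<Rightarrow> 'b::real_normed_vector) \<Rightarrow> 'a set \<Rightarrow> bool"
  where "C2_on f S \<longleftrightarrow>
    (\<exists>f' :: 'a \<Rightarrow> 'a \<Rightarrow>\<^sub>L 'b.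
       (\<forall>x\<in>S. (f has_derivative blinfun_apply (f' x)) (at x)) \<and> C1_on f' S)"

text \<open>The parameter space $\mathcal{A}^d$ is \<open>{\<alpha>. \<forall>i. \<alpha> $ i \<in> A}\<close>, a subset of
  \<open>real ^ 'm ^ 'd\<close>.\<close>

definition param_power :: "(real ^ 'm) set \<Rightarrow> (real ^ 'm ^ 'd) set"
  where "param_power A = {\<alpha>. \<forall>i. \<alpha> $ i \<in> A}"

definition encoding_map ::
    "(real ^ 'm \<Rightarrow> real ^ 'd \<Rightarrow> real) \<Rightarrow> real ^ 'm ^ 'd \<Rightarrow> real ^ 'd \<Rightarrow> real ^ 'd"
  where "encoding_map \<phi> \<alpha> x = (\<chi> i. \<phi> (\<alpha> $ i) x)"

definition jac_det :: "(real ^ 'd \<Rightarrow> real ^ 'd) \<Rightarrow> real ^ 'd \<Rightarrow> real"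
  where "jac_det F x = det (jacobian F (at x))"

definition critical_points :: "(real ^ 'd \<Rightarrow> real ^ 'd) \<Rightarrow> (real ^ 'd) set"
  where "critical_points F = {x. rank (jacobian F (at x)) \<le> CARD('d) - 1}"

definition fold_nondegenerate_at :: "(real ^ 'd \<Rightarrow> real ^ 'd) \<Rightarrow> real ^ 'd \<Rightarrow> bool"
  where "fold_nondegenerate_at F x \<longleftrightarrow>
    rank (jacobian F (at x)) = CARD('d) - 1 \<and>
    (\<forall>v. jacobian F (at x) *v v = 0 \<and> v \<noteq> 0 \<longrightarrow>
         frechet_derivative (jac_det F) (at x) v \<noteq> 0)"

text \<open>A \<open>k\<close>-dimensional embedded $C^1$ submanifold, in the slice form: near each of its
  points a $C^1$ diffeomorphism between open sets straightens \<open>M\<close> to a \<open>k\<close>-dimensional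
  linear subspace. The empty set qualifies.\<close>

definition C1_submanifold :: "nat \<Rightarrow> 'a::euclidean_space set \<Rightarrow> bool"
  where "C1_submanifold k M \<longleftrightarrow>
    (\<forall>p\<in>M. \<exists>N N' \<psi> \<psi>' L.
       open N \<and> p \<in> N \<and> open (N' :: 'a set) \<and> homeomorphism N N' \<psi> \<psi>' \<and>
       C1_on \<psi> N \<and> C1_on \<psi>' N' \<and>
       subspace L \<and> dim L = k \<and> \<psi> ` (M \<inter> N) = L \<inter> N')"

text \<open>The tangent space as the set of velocities of $C^1$ curves in \<open>M\<close>.\<close>

definition tangent_space :: "'a::euclidean_space set \<Rightarrow> 'a \<Rightarrow> 'a set"
  where "tangent_space M p =
    {v. \<exists>\<gamma> \<epsilon>. \<epsilon> > 0 \<and> \<gamma> C1_differentiable_on {-\<epsilon><..<\<epsilon>} \<and>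
          (\<forall>t\<in>{-\<epsilon><..<\<epsilon>}. \<gamma> t \<in> M) \<and> \<gamma> 0 = p \<and>
          (\<gamma> has_vector_derivative v) (at 0)}"

text \<open>The rank of the restriction of $D_xF(x)$ to $T_xM$ is the dimension of the image.
  For open \<open>W\<close> the derivatives of the restriction of \<open>F\<close> to \<open>W\<close> at points of \<open>W\<close> are
  those of \<open>F\<close>.\<close>

definition critical_hypersurface_tangential_immersion_on ::
    "(real ^ 'd \<Rightarrow> real ^ 'd) \<Rightarrow> (real ^ 'd) set \<Rightarrow> bool"
  where "critical_hypersurface_tangential_immersion_on F W \<longleftrightarrow>
    (\<exists>M. M \<subseteq> W \<and> C1_submanifold (CARD('d) - 1) M \<and>
         critical_points F \<inter> W \<subseteq> M \<and>
         (\<forall>x\<in>M. dim ((\<lambda>v. jacobian F (at x) *v v) ` tangent_space M x) = CARD('d) - 1))"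

end

theory Submission
  imports Defs
begin

text \<open>Fold non-degeneracy at a critical point says that no unit vector is annihilated by both the
  derivative of the encoding map and the derivative of its Jacobian determinant \<open>J\<close>. At
  non-critical points no unit vector is annihilated by the former, so over a compact set the
  condition says that a continuous function of the parameter, the point and the unit vector does
  not vanish on a compact fibre; the tube lemma makes this stable in the parameter. On an open set
  of fold points the critical set \<open>{J = 0}\<close> is a regular level set, hence a hypersurface,
  and its tangent space contains the kernel of \<open>DJ\<close>, on which the derivative of the encoding
  map is injective.\<close>

section \<open>C^1 maps in terms of directional derivatives\<close>

text \<open>In finite dimension, operator-norm continuity of the derivative amounts to continuity of
  its value on each fixed vector. Derivatives can then be written as plain functions instead of
  bundled bounded linear maps.\<close>

lemma C1_on_iff:
  fixes f :: "'a::euclidean_space \<Rightarrow> 'b::real_normed_vector"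
  shows "C1_on f S \<longleftrightarrow>
    (\<exists>D. (\<forall>x\<in>S. (f has_derivative D x) (at x)) \<and> (\<forall>v. continuous_on S (\<lambda>x. D x v)))"
proof
  assume "C1_on f S"
  then obtain f' :: "'a \<Rightarrow> 'a \<Rightarrow>\<^sub>L 'b"
    where "\<forall>x\<in>S. (f has_derivative blinfun_apply (f' x)) (at x)" "continuous_on S f'"
    unfolding C1_on_def by blast
  then show "\<exists>D. (\<forall>x\<in>S. (f has_derivative D x) (at x)) \<and> (\<forall>v. continuous_on S (\<lambda>x. D x v))"
    by (intro exI[of _ "\<lambda>x. blinfun_apply (f' x)"]) (auto intro!: continuous_intros)
next
  assume "\<exists>D. (\<forall>x\<in>S. (f has_derivative D x) (at x)) \<and> (\<forall>v. continuous_on S (\<lambda>x. D x v))"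
  then obtain D where D: "\<And>x. x \<in> S \<Longrightarrow> (f has_derivative D x) (at x)"
    and cont: "\<And>v. continuous_on S (\<lambda>x. D x v)"
    by blast
  have app: "blinfun_apply (Blinfun (D x)) = D x" if "x \<in> S" for x
    using D[OF that] by (simp add: bounded_linear_Blinfun_apply has_derivative_bounded_linear)
  have "continuous_on S (\<lambda>x. Blinfun (D x))"
  proof (rule continuous_on_blinfun_componentwise)
    fix i :: 'a
    show "continuous_on S (\<lambda>x. blinfun_apply (Blinfun (D x)) i)"
      using cont[of i] by (simp add: app cong: continuous_on_cong)
  qed
  with D app show "C1_on f S"
    unfolding C1_on_def by (intro exI[of _ "\<lambda>x. Blinfun (D x)"]) auto
qed

lemma C1_on_imp_continuous_on: "C1_on f S \<Longrightarrow> continuous_on S f"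
  unfolding C1_on_def
  by (meson continuous_at_imp_continuous_on has_derivative_continuous)

lemma C1_on_subset: "C1_on f S \<Longrightarrow> T \<subseteq> S \<Longrightarrow> C1_on f T"
  unfolding C1_on_def by (fast intro: continuous_on_subset)

lemma C1_on_prod:
  fixes f :: "'i \<Rightarrow> 'a::euclidean_space \<Rightarrow> real"
  assumes "\<And>i. i \<in> I \<Longrightarrow> C1_on (f i) S"
  shows "C1_on (\<lambda>x. \<Prod>i\<in>I. f i x) S"
proof -
  have "\<forall>i\<in>I. \<exists>D. (\<forall>x\<in>S. (f i has_derivative D x) (at x)) \<and> (\<forall>v. continuous_on S (\<lambda>x. D x v))"
    using assms by (auto simp: C1_on_iff)
  then obtain D where D: "\<And>i x. i \<in> I \<Longrightarrow> x \<in> S \<Longrightarrow> (f i has_derivative D i x) (at x)"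
    and cont: "\<And>i v. i \<in> I \<Longrightarrow> continuous_on S (\<lambda>x. D i x v)"
    by metis
  have "continuous_on S (f i)" if "i \<in> I" for i
    using assms that by (blast intro: C1_on_imp_continuous_on)
  then show ?thesis
    unfolding C1_on_iff
    by (intro exI[of _ "\<lambda>x v. \<Sum>i\<in>I. D i x v * (\<Prod>j\<in>I - {i}. f j x)"])
       (auto intro!: has_derivative_prod D continuous_intros cont)
qed

lemma C1_on_sum_scaled:
  fixes f :: "'i \<Rightarrow> 'a::euclidean_space \<Rightarrow> real"
  assumes "\<And>i. i \<in> I \<Longrightarrow> C1_on (f i) S"
  shows "C1_on (\<lambda>x. \<Sum>i\<in>I. c i * f i x) S"
proof -
  have "\<forall>i\<in>I. \<exists>D. (\<forall>x\<in>S. (f i has_derivative D x) (at x)) \<and> (\<forall>v. continuous_on S (\<lambda>x. D x v))"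
    using assms by (auto simp: C1_on_iff)
  then obtain D where D: "\<And>i x. i \<in> I \<Longrightarrow> x \<in> S \<Longrightarrow> (f i has_derivative D i x) (at x)"
    and cont: "\<And>i v. i \<in> I \<Longrightarrow> continuous_on S (\<lambda>x. D i x v)"
    by metis
  then show ?thesis
    unfolding C1_on_iff
    by (intro exI[of _ "\<lambda>x v. \<Sum>i\<in>I. c i * D i x v"])
       (auto intro!: has_derivative_sum has_derivative_mult_right continuous_intros)
qed

text \<open>By the Leibniz formula the determinant is a signed sum of products of entries.\<close>

lemma C1_on_det:
  fixes M :: "'a::euclidean_space \<Rightarrow> real ^ 'n ^ 'n"
  assumes "\<And>i j. C1_on (\<lambda>x. M x $ i $ j) S"
  shows "C1_on (\<lambda>x. det (M x)) S"
  unfolding det_def by (rule C1_on_sum_scaled, rule C1_on_prod, rule assms)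

section \<open>Regular level sets and their tangent vectors\<close>

text \<open>The map straightening the level set of \<open>J\<close> is
  \<open>x \<mapsto> x - p + (J x - n \<bullet> (x - p)) n / (n \<bullet> n)\<close> with \<open>n\<close> the gradient at \<open>p\<close>: its
  \<open>n\<close>-component is \<open>J\<close>, its derivative at \<open>p\<close> is the identity, and the inverse of its derivative
  has a closed form, which yields the continuity of the derivative of the inverse map.\<close>

lemma level_set_straightening:
  fixes J :: "'a::euclidean_space \<Rightarrow> real"
  assumes W: "open W" "p \<in> W" and derJ: "\<And>x. x \<in> W \<Longrightarrow> (J has_derivative DJ x) (at x)"
    and contDJ: "\<And>v. continuous_on W (\<lambda>x. DJ x v)"
    and "J p = 0" and "DJ p \<noteq> (\<lambda>v. 0)"
  obtains n N N' \<psi> \<psi>' D' where "n \<noteq> 0" "\<And>v. DJ p v = n \<bullet> v" "open N" "p \<in> N" "N \<subseteq> W" "open N'"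
    "homeomorphism N N' \<psi> \<psi>'" "C1_on \<psi> N" "\<And>x. n \<bullet> \<psi> x = J x" "\<psi> p = 0"
    "\<And>y. y \<in> N' \<Longrightarrow> (\<psi>' has_derivative D' y) (at y)"
    "\<And>v. continuous_on N' (\<lambda>y. D' y v)"
    "\<And>v. DJ p v = 0 \<Longrightarrow> D' 0 v = v"
proof -
  \<comment> \<open>The Riesz vector of the functional \<open>DJ p\<close>, that is, the gradient of
    \<open>J\<close> at \<open>p\<close>.\<close>
  define n where "n = adjoint (DJ p) 1"
  have linJ: "linear (DJ x)" if "x \<in> W" for x
    using derJ[OF that] has_derivative_linear by blast
  have n: "DJ p v = n \<bullet> v" for v
    using adjoint_works[OF linJ[OF W(2)], of v 1] by (simp add: n_def inner_commute)
  have "n \<noteq> 0" using assms(6) n by auto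
  then have nn: "n \<bullet> n \<noteq> 0" by simp
  define \<psi> where "\<psi> x = x - p + ((J x - n \<bullet> (x - p)) / (n \<bullet> n)) *\<^sub>R n" for x
  define D where "D x v = v + ((DJ x v - n \<bullet> v) / (n \<bullet> n)) *\<^sub>R n" for x v
  \<comment> \<open>\<open>D x\<close> is a rank-one perturbation of the identity with determinant
    \<open>DJ x n / (n \<bullet> n)\<close>, so \<open>W0\<close> is the set of points where it is
    invertible. It contains \<open>p\<close> because \<open>DJ p n = n \<bullet> n\<close>.\<close>
  define W0 where "W0 = {x \<in> W. DJ x n \<noteq> 0}"
  have "open W0"
    using continuous_open_preimage[OF contDJ[of n] W(1), of "- {0}"]
    by (auto simp: W0_def Int_def vimage_def open_Compl)
  have "p \<in> W0" using W nn n by (simp add: W0_def)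
  have "W0 \<subseteq> W" by (auto simp: W0_def)
  have der: "(\<psi> has_derivative D x) (at x)" if "x \<in> W" for x
    unfolding \<psi>_def[abs_def] D_def[abs_def]
    by (auto intro!: derivative_eq_intros derJ that simp: nn divide_inverse)
  have contD: "continuous_on W0 (\<lambda>x. D x v)" for v
    unfolding D_def
    by (intro continuous_intros continuous_on_subset[OF contDJ] \<open>W0 \<subseteq> W\<close>) (use nn in auto)
  have bl: "bounded_linear (D x)" if "x \<in> W" for x
    using der[OF that] has_derivative_bounded_linear by blast
  have Dp: "D p v = v" for v by (simp add: D_def n)
  have "C1_on \<psi> W0"
    unfolding C1_on_iff using der contD \<open>W0 \<subseteq> W\<close> by (intro exI[of _ D]) auto
  define f' where "f' x = Blinfun (D x)" for x
  have f': "blinfun_apply (f' x) = D x" if "x \<in> W" for x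
    using bl[OF that] by (simp add: f'_def bounded_linear_Blinfun_apply)
  have contf': "continuous_on W0 f'"
  proof (rule continuous_on_blinfun_componentwise)
    fix i :: 'a
    show "continuous_on W0 (\<lambda>x. blinfun_apply (f' x) i)"
      using contD[of i] \<open>W0 \<subseteq> W\<close> by (subst continuous_on_cong[OF refl]) (auto simp: f')
  qed
  have inv_id: "id_blinfun o\<^sub>L f' p = id_blinfun"
    by (rule blinfun_eqI) (simp add: f' W Dp)
  obtain N N' \<psi>' D' where N: "open N" "N \<subseteq> W0" "p \<in> N" "open N'" "\<psi> p \<in> N'"
    and hom: "homeomorphism N N' \<psi> \<psi>'"
    and der': "\<And>y. y \<in> N' \<Longrightarrow> (\<psi>' has_derivative D' y) (at y)"
    and inv': "\<And>y. y \<in> N' \<Longrightarrow> D' y = inv (blinfun_apply (f' (\<psi>' y)))"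
    and bij: "\<And>y. y \<in> N' \<Longrightarrow> bij (blinfun_apply (f' (\<psi>' y)))"
  proof (rule inverse_function_theorem[OF \<open>open W0\<close> _ contf' \<open>p \<in> W0\<close> inv_id, of \<psi>])
    show "(\<psi> has_derivative blinfun_apply (f' x)) (at x)" if "x \<in> W0" for x
      using der that \<open>W0 \<subseteq> W\<close> by (auto simp: f')
  qed auto
  have in_W0: "\<psi>' y \<in> W0" if "y \<in> N'" for y
    using hom that N(2) unfolding homeomorphism_def by blast
  \<comment> \<open>The Sherman-Morrison formula for the inverse of a rank-one perturbation of the
    identity. The denominator does not vanish because \<open>\<psi>' y\<close> lies in
    \<open>W0\<close>, so the right-hand side is visibly continuous in \<open>y\<close>.\<close>
  have D'_eq: "D' y w = w - ((DJ (\<psi>' y) w - n \<bullet> w) / DJ (\<psi>' y) n) *\<^sub>R n" if "y \<in> N'" for y w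
  proof -
    let ?x = "\<psi>' y"
    let ?s = "(DJ ?x w - n \<bullet> w) / DJ ?x n"
    have x: "?x \<in> W" "DJ ?x n \<noteq> 0" using in_W0[OF that] by (auto simp: W0_def)
    have "DJ ?x (w - ?s *\<^sub>R n) = n \<bullet> w"
      using x by (simp add: linear_diff[OF linJ] linear_cmul[OF linJ])
    then have "D ?x (w - ?s *\<^sub>R n) = w - ?s *\<^sub>R n + ((?s * (n \<bullet> n)) / (n \<bullet> n)) *\<^sub>R n"
      by (simp add: D_def inner_diff_right)
    then have "D ?x (w - ?s *\<^sub>R n) = w"
      using nn by simp
    then show ?thesis
      using bij[OF that] inv'[OF that] x by (metis bij_inv_eq_iff f')
  qed
  have cont': "continuous_on N' (\<lambda>y. D' y v)" for v
  proof -
    have c: "continuous_on N' (\<lambda>y. DJ (\<psi>' y) u)" for u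
      using hom in_W0 \<open>W0 \<subseteq> W\<close> unfolding homeomorphism_def
      by (intro continuous_on_compose2[OF contDJ]) blast+
    have "continuous_on N' (\<lambda>y. v - ((DJ (\<psi>' y) v - n \<bullet> v) / DJ (\<psi>' y) n) *\<^sub>R n)"
      using in_W0 by (intro continuous_intros c) (auto simp: W0_def)
    then show ?thesis
      by (simp add: D'_eq cong: continuous_on_cong)
  qed
  have \<psi>p: "\<psi> p = 0" by (simp add: \<psi>_def \<open>J p = 0\<close>)
  have "\<psi>' 0 = p" using hom N(3) \<psi>p unfolding homeomorphism_def by metis
  then have "D' 0 v = v" if "DJ p v = 0" for v
    using that N(5) \<psi>p by (simp add: D'_eq n)
  moreover have "n \<bullet> \<psi> x = J x" for x
    using nn by (simp add: \<psi>_def inner_add_right inner_diff_right)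
  ultimately show thesis
    using that[of n N N' \<psi> \<psi>' D'] \<open>n \<noteq> 0\<close> n N hom der' cont' \<psi>p \<open>W0 \<subseteq> W\<close>
      C1_on_subset[OF \<open>C1_on \<psi> W0\<close> N(2)] by blast
qed

text \<open>The straightening turns the level set near \<open>p\<close> into a piece of the
  hyperplane orthogonal to the gradient \<open>n\<close>, which gives the slice chart. Pulling the
  line spanned by \<open>v\<close> back through the inverse chart gives a curve in the level set
  with velocity \<open>v\<close>.\<close>

lemma regular_level_set:
  fixes J :: "'a::euclidean_space \<Rightarrow> real"
  assumes W: "open W" and derJ: "\<And>x. x \<in> W \<Longrightarrow> (J has_derivative DJ x) (at x)"
    and contDJ: "\<And>v. continuous_on W (\<lambda>x. DJ x v)"
    and reg: "\<And>x. x \<in> W \<Longrightarrow> J x = 0 \<Longrightarrow> DJ x \<noteq> (\<lambda>v. 0)"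
  shows C1_submanifold_level_set: "C1_submanifold (DIM('a) - 1) {x \<in> W. J x = 0}"
    and kernel_subset_tangent_space:
      "p \<in> W \<Longrightarrow> J p = 0 \<Longrightarrow> {v. DJ p v = 0} \<subseteq> tangent_space {x \<in> W. J x = 0} p"
proof -
  show "C1_submanifold (DIM('a) - 1) {x \<in> W. J x = 0}"
    unfolding C1_submanifold_def
  proof
    fix p assume "p \<in> {x \<in> W. J x = 0}"
    then have p: "p \<in> W" "J p = 0" by auto
    obtain n N N' \<psi> \<psi>' D' where *: "n \<noteq> 0" "\<And>v. DJ p v = n \<bullet> v" "open N" "p \<in> N" "N \<subseteq> W"
      "open N'" "homeomorphism N N' \<psi> \<psi>'" "C1_on \<psi> N" "\<And>x. n \<bullet> \<psi> x = J x" "\<psi> p = 0"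
      "\<And>y. y \<in> N' \<Longrightarrow> (\<psi>' has_derivative D' y) (at y)"
      "\<And>v. continuous_on N' (\<lambda>y. D' y v)"
      "\<And>v. DJ p v = 0 \<Longrightarrow> D' 0 v = v"
      by (rule level_set_straightening[OF W p(1) derJ contDJ p(2) reg[OF p]]) blast+
    have C1': "C1_on \<psi>' N'"
      unfolding C1_on_iff using * by (intro exI[of _ D']) auto
    \<comment> \<open>Since \<open>n \<bullet> \<psi> x = J x\<close>, the condition
      \<open>J x = 0\<close> reads in the chart as membership in the hyperplane.\<close>
    have slice: "\<psi> ` ({x \<in> W. J x = 0} \<inter> N) = {y. n \<bullet> y = 0} \<inter> N'"
      using *(5,9) homeomorphism_image1[OF *(7)] by fastforce
    show "\<exists>N N' \<psi> \<psi>' L. open N \<and> p \<in> N \<and> open (N' :: 'a set) \<and> homeomorphism N N' \<psi> \<psi>' \<and>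
        C1_on \<psi> N \<and> C1_on \<psi>' N' \<and> subspace L \<and> dim L = DIM('a) - 1 \<and>
        \<psi> ` ({x \<in> W. J x = 0} \<inter> N) = L \<inter> N'"
      using *(3,4,6,7,8) C1' slice subspace_hyperplane[of n] dim_hyperplane[OF *(1)] by blast
  qed
next
  assume p: "p \<in> W" "J p = 0"
  obtain n N N' \<psi> \<psi>' D' where *: "n \<noteq> 0" "\<And>v. DJ p v = n \<bullet> v" "open N" "p \<in> N" "N \<subseteq> W"
    "open N'" "homeomorphism N N' \<psi> \<psi>'" "C1_on \<psi> N" "\<And>x. n \<bullet> \<psi> x = J x" "\<psi> p = 0"
    "\<And>y. y \<in> N' \<Longrightarrow> (\<psi>' has_derivative D' y) (at y)"
    "\<And>v. continuous_on N' (\<lambda>y. D' y v)"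
    "\<And>v. DJ p v = 0 \<Longrightarrow> D' 0 v = v"
    by (rule level_set_straightening[OF W p(1) derJ contDJ p(2) reg[OF p]]) blast+
  have hom: "\<And>y. y \<in> N' \<Longrightarrow> \<psi>' y \<in> N \<and> \<psi> (\<psi>' y) = y" "\<And>x. x \<in> N \<Longrightarrow> \<psi> x \<in> N' \<and> \<psi>' (\<psi> x) = x"
    using *(7) unfolding homeomorphism_def by auto
  have "0 \<in> N'" "\<psi>' 0 = p" using hom(2)[OF *(4)] *(10) by auto
  show "{v. DJ p v = 0} \<subseteq> tangent_space {x \<in> W. J x = 0} p"
  proof
    fix v assume "v \<in> {v. DJ p v = 0}"
    then have v: "n \<bullet> v = 0" "D' 0 v = v" using * by auto
    \<comment> \<open>The curve will be \<open>\<psi>' (t *\<^sub>R v)\<close>; openness of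
      \<open>N'\<close> around 0 gives an interval of parameters on which it is defined.\<close>
    have "open ((\<lambda>t. t *\<^sub>R v) -` N')"
      by (intro continuous_open_vimage *(6)) (auto intro!: continuous_intros)
    then obtain \<epsilon> :: real where \<epsilon>: "\<epsilon> > 0" "ball 0 \<epsilon> \<subseteq> (\<lambda>t. t *\<^sub>R v) -` N'"
      using \<open>0 \<in> N'\<close> by (metis openE scaleR_zero_left vimageI)
    have inN: "t *\<^sub>R v \<in> N'" if "t \<in> {-\<epsilon><..<\<epsilon>}" for t
      using \<epsilon>(2) that by (auto simp: subset_eq dist_real_def)
    have der: "((\<lambda>t. \<psi>' (t *\<^sub>R v)) has_vector_derivative D' (t *\<^sub>R v) v) (at t)"
      if t: "t \<in> {-\<epsilon><..<\<epsilon>}" for t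
    proof -
      have "((\<lambda>t. \<psi>' (t *\<^sub>R v)) has_derivative (\<lambda>s. D' (t *\<^sub>R v) (s *\<^sub>R v))) (at t)"
        by (rule has_derivative_compose[OF
              bounded_linear_imp_has_derivative[OF bounded_linear_scaleR_left] *(11)[OF inN[OF t]]])
      then show ?thesis
        using has_derivative_linear[OF *(11)[OF inN[OF t]]]
        by (simp add: has_vector_derivative_def linear_cmul)
    qed
    have "continuous_on {-\<epsilon><..<\<epsilon>} (\<lambda>t. D' (t *\<^sub>R v) v)"
      by (rule continuous_on_compose2[OF *(12)]) (auto intro!: continuous_intros inN)
    with der have "(\<lambda>t. \<psi>' (t *\<^sub>R v)) C1_differentiable_on {-\<epsilon><..<\<epsilon>}"
      unfolding C1_differentiable_on_def by (intro exI[of _ "\<lambda>t. D' (t *\<^sub>R v) v"]) simp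
    moreover have "\<psi>' (t *\<^sub>R v) \<in> {x \<in> W. J x = 0}" if "t \<in> {-\<epsilon><..<\<epsilon>}" for t
      using hom(1)[OF inN[OF that]] *(5) *(9)[of "\<psi>' (t *\<^sub>R v)"] v by auto
    moreover have "((\<lambda>t. \<psi>' (t *\<^sub>R v)) has_vector_derivative v) (at 0)"
      using der[of 0] \<epsilon>(1) v by simp
    ultimately show "v \<in> tangent_space {x \<in> W. J x = 0} p"
      unfolding tangent_space_def using \<epsilon>(1) \<open>\<psi>' 0 = p\<close>
      by (intro CollectI exI[of _ "\<lambda>t. \<psi>' (t *\<^sub>R v)"] exI[of _ \<epsilon>]) auto
  qed
qed

section \<open>Linear algebra of the fold condition\<close>

lemma critical_points_iff: "x \<in> critical_points F \<longleftrightarrow> jac_det F x = 0"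
  for F :: "real ^ 'd \<Rightarrow> real ^ 'd"
proof -
  have "0 < CARD('d)" by simp
  then show ?thesis
    unfolding critical_points_def jac_det_def det_eq_0_rank by (simp; linarith)
qed

text \<open>The kernel of a functional is a hyperplane or the whole space, and \<open>B\<close> is
  injective on it. The bound serves twice: to recover the rank condition at fold points, and to
  bound the rank along the tangent space from below.\<close>

lemma dim_image_kernel_ge:
  fixes B :: "real ^ 'd ^ 'd" and l :: "real ^ 'd \<Rightarrow> real"
  assumes "linear l" and inj: "\<And>v. B *v v = 0 \<Longrightarrow> l v = 0 \<Longrightarrow> v = 0"
  shows "CARD('d) - 1 \<le> dim ((*v) B ` {v. l v = 0})"
proof -
  let ?L = "{v. l v = 0}"
  have L: "?L = {v. adjoint l 1 \<bullet> v = 0}"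
    using adjoint_works[OF assms(1), of _ 1] by (auto simp: inner_commute)
  have sub: "subspace ?L"
    unfolding L by (rule subspace_hyperplane)
  have "inj_on ((*v) B) ?L"
  proof (rule inj_onI)
    fix x y assume "x \<in> ?L" "y \<in> ?L" "B *v x = B *v y"
    then show "x = y"
      using inj[of "x - y"] by (simp add: matrix_vector_mult_diff_distrib linear_diff[OF assms(1)])
  qed
  then have "dim ((*v) B ` ?L) = dim ?L"
    using sub by (intro dim_image_eq) (auto simp: span_eq_iff[THEN iffD2])
  moreover have "CARD('d) - 1 \<le> dim ?L"
  proof (cases "adjoint l 1 = 0")
    case True
    then show ?thesis unfolding L by simp
  next
    case False
    then show ?thesis unfolding L by (simp add: dim_hyperplane)
  qed
  ultimately show ?thesis by simp
qed

text \<open>By homogeneity it suffices to test unit vectors, and the rank condition is automatic: the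
  kernel of the Jacobian matrix meets that of the derivative of the Jacobian determinant trivially,
  so it has dimension at most 1.\<close>

lemma fold_nondegenerate_iff:
  fixes F :: "real ^ 'd \<Rightarrow> real ^ 'd"
  assumes der: "(jac_det F has_derivative l) (at x)" and crit: "x \<in> critical_points F"
  shows "fold_nondegenerate_at F x \<longleftrightarrow>
    (\<forall>v\<in>sphere 0 1. \<not> (jacobian F (at x) *v v = 0 \<and> l v = 0))"
proof -
  have l: "frechet_derivative (jac_det F) (at x) = l"
    using frechet_derivative_at[OF der] by simp
  have lin: "linear l" using der has_derivative_linear by blast
  let ?B = "jacobian F (at x)"
  show ?thesis
  proof
    assume "fold_nondegenerate_at F x"
    then show "\<forall>v\<in>sphere 0 1. \<not> (?B *v v = 0 \<and> l v = 0)"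
      unfolding fold_nondegenerate_at_def l by force
  next
    assume *: "\<forall>v\<in>sphere 0 1. \<not> (?B *v v = 0 \<and> l v = 0)"
    have nz: "v = 0" if "?B *v v = 0" "l v = 0" for v
    proof (rule ccontr)
      assume "v \<noteq> 0"
      then have "v /\<^sub>R norm v \<in> sphere 0 1" by simp
      moreover have "?B *v (v /\<^sub>R norm v) = 0" "l (v /\<^sub>R norm v) = 0"
        using that by (simp_all add: matrix_vector_mult_scaleR linear_cmul[OF lin])
      ultimately show False using * by blast
    qed
    have "CARD('d) - 1 \<le> dim ((*v) ?B ` {v. l v = 0})"
      by (rule dim_image_kernel_ge[OF lin nz])
    also have "\<dots> \<le> rank ?B"
      unfolding rank_dim_range by (intro dim_subset) auto
    finally show "fold_nondegenerate_at F x"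
      using crit nz unfolding fold_nondegenerate_at_def l critical_points_def by auto
  qed
qed

section \<open>From fold points to the hypersurface and immersion conditions\<close>

text \<open>The submanifold is the critical set in \<open>W\<close> itself. The dimension of the
  image of its tangent space is at most the rank of the Jacobian, and at least \<open>d - 1\<close>
  because the tangent space contains the kernel of \<open>D x\<close>, on which the Jacobian is
  injective.\<close>

lemma fold_imp_critical_hypersurface:
  fixes F :: "real ^ 'd \<Rightarrow> real ^ 'd"
  assumes "CARD('d) \<ge> 2" and W: "open W" and "C1_on (jac_det F) W"
    and fold: "\<And>x. x \<in> critical_points F \<inter> W \<Longrightarrow> fold_nondegenerate_at F x"
  shows "critical_hypersurface_tangential_immersion_on F W"
proof -
  obtain D where D: "\<And>x. x \<in> W \<Longrightarrow> (jac_det F has_derivative D x) (at x)"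
    and cont: "\<And>v. continuous_on W (\<lambda>x. D x v)"
    using assms(3) unfolding C1_on_iff by blast
  have DF: "frechet_derivative (jac_det F) (at x) = D x" if "x \<in> W" for x
    using frechet_derivative_at[OF D[OF that]] by simp
  let ?M = "{x \<in> W. jac_det F x = 0}"
  have M: "rank (jacobian F (at x)) = CARD('d) - 1"
    "\<And>v. jacobian F (at x) *v v = 0 \<Longrightarrow> D x v = 0 \<Longrightarrow> v = 0" if "x \<in> ?M" for x
    using fold[of x] that DF[of x] by (auto simp: fold_nondegenerate_at_def critical_points_iff)
  \<comment> \<open>If \<open>D x\<close> vanished, the fold condition would make the Jacobian
    injective, although its rank is only \<open>d - 1\<close>.\<close>
  have reg: "D x \<noteq> (\<lambda>v. 0)" if x: "x \<in> W" "jac_det F x = 0" for x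
  proof
    assume 0: "D x = (\<lambda>v. 0)"
    have "rank (jacobian F (at x)) \<noteq> CARD('d)"
      using M(1)[of x] x assms(1) by auto
    then show False
      using M(2)[of x] x 0 by (metis (mono_tags, lifting) matrix_nonfull_linear_equations_eq mem_Collect_eq)
  qed
  have "dim ((*v) (jacobian F (at x)) ` tangent_space ?M x) = CARD('d) - 1" if x: "x \<in> ?M" for x
  proof (rule antisym)
    have "dim ((*v) (jacobian F (at x)) ` tangent_space ?M x) \<le> rank (jacobian F (at x))"
      unfolding rank_dim_range by (intro dim_subset) auto
    then show "dim ((*v) (jacobian F (at x)) ` tangent_space ?M x) \<le> CARD('d) - 1"
      using M(1)[OF x] by simp
    have "CARD('d) - 1 \<le> dim ((*v) (jacobian F (at x)) ` {v. D x v = 0})"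
      using x M(2)[OF x] has_derivative_linear[OF D] by (intro dim_image_kernel_ge) auto
    also have "\<dots> \<le> dim ((*v) (jacobian F (at x)) ` tangent_space ?M x)"
      by (intro dim_subset image_mono kernel_subset_tangent_space[OF W D cont reg]) (use x in auto)
    finally show "CARD('d) - 1 \<le> dim ((*v) (jacobian F (at x)) ` tangent_space ?M x)" .
  qed
  moreover have "C1_submanifold (CARD('d) - 1) ?M"
    by (rule C1_submanifold_level_set[OF W D cont reg, unfolded DIM_cart DIM_real mult_1_right])
  ultimately show ?thesis
    unfolding critical_hypersurface_tangential_immersion_on_def
    by (intro exI[of _ ?M]) (auto simp: critical_points_iff)
qed

section \<open>Joint dependence on parameter and point\<close>

lemma open_param_power: "open A \<Longrightarrow> open (param_power A :: (real ^ 'm ^ 'd) set)"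
  unfolding param_power_def by (rule open_vector_box) simp

lemma has_derivative_encoding_map:
  fixes \<phi> :: "real ^ 'm \<Rightarrow> real ^ 'd \<Rightarrow> real"
  assumes "\<And>z. z \<in> A \<times> UNIV \<Longrightarrow> ((\<lambda>(\<alpha>, x). \<phi> \<alpha> x) has_derivative blinfun_apply (f' z)) (at z)"
    and "\<beta> \<in> param_power A"
  shows "(encoding_map \<phi> \<beta> has_derivative (\<lambda>v. \<chi> i. f' (\<beta> $ i, x) (0, v))) (at x)"
proof -
  have "((\<lambda>x. \<phi> (\<beta> $ i) x) has_derivative (\<lambda>v. f' (\<beta> $ i, x) (0, v))) (at x)" for i
  proof -
    have d: "((\<lambda>x. (\<beta> $ i, x)) has_derivative (\<lambda>v. (0, v))) (at x)"
      by (rule has_derivative_Pair[OF has_derivative_const has_derivative_ident])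
    have "(\<beta> $ i, x) \<in> A \<times> UNIV"
      using assms(2) by (simp add: param_power_def)
    from has_derivative_compose[OF d assms(1)[OF this]] show ?thesis
      by simp
  qed
  then show ?thesis
    unfolding encoding_map_def[abs_def]
    by (subst has_derivative_componentwise_within)
       (simp add: Basis_vec_def inner_axis)
qed

text \<open>Meant for the entries of the Jacobian matrix: \<open>g\<close> selects one component of
  the parameter together with the point, \<open>f\<close> is the derivative of the joint map, and
  \<open>h\<close> evaluates it in a coordinate direction.\<close>

lemma C1_on_compose_bounded_linear:
  fixes f :: "'b::euclidean_space \<Rightarrow> 'c::real_normed_vector"
    and g :: "'a::euclidean_space \<Rightarrow> 'b" and h :: "'c \<Rightarrow> 'e::real_normed_vector"
  assumes "C1_on f T" and g: "bounded_linear g" and h: "bounded_linear h"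
    and "\<And>x. x \<in> S \<Longrightarrow> g x \<in> T"
  shows "C1_on (\<lambda>x. h (f (g x))) S"
proof -
  obtain D where D: "\<And>x. x \<in> T \<Longrightarrow> (f has_derivative D x) (at x)"
    and cont: "\<And>v. continuous_on T (\<lambda>x. D x v)"
    using assms(1) unfolding C1_on_iff by blast
  have "((\<lambda>x. h (f (g x))) has_derivative (\<lambda>v. h (D (g x) (g v)))) (at x)" if "x \<in> S" for x
    by (rule bounded_linear.has_derivative[OF h has_derivative_compose[OF
          bounded_linear_imp_has_derivative[OF g] D[OF assms(4)[OF that]]]])
  moreover have "continuous_on S (\<lambda>x. h (D (g x) (g v)))" for v
    by (rule bounded_linear.continuous_on[OF h continuous_on_compose2[OF cont
          linear_continuous_on[OF g]]]) (use assms(4) in auto)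
  ultimately show ?thesis
    unfolding C1_on_iff by (intro exI[of _ "\<lambda>x v. h (D (g x) (g v))"]) auto
qed

section \<open>Stability under perturbation of the parameter\<close>

theorem theorem4p10:
  fixes A :: "(real ^ 'm) set"
    and \<phi> :: "real ^ 'm \<Rightarrow> real ^ 'd \<Rightarrow> real"
    and K U :: "(real ^ 'd) set"
    and \<alpha>0 :: "real ^ 'm ^ 'd"
  assumes "CARD('d) \<ge> 2"
    and "open A"
    and "C2_on (\<lambda>(\<alpha>, x). \<phi> \<alpha> x) (A \<times> UNIV)"
    and "compact K" and "open U" and "K \<subseteq> U"
    and "\<alpha>0 \<in> param_power A"
    and "\<forall>x \<in> critical_points (encoding_map \<phi> \<alpha>0) \<inter> closure U.
           fold_nondegenerate_at (encoding_map \<phi> \<alpha>0) x"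
  shows "\<exists>V. open V \<and> \<alpha>0 \<in> V \<and> V \<subseteq> param_power A \<and>
      (\<forall>\<beta>\<in>V. \<forall>x \<in> critical_points (encoding_map \<phi> \<beta>) \<inter> K.
         fold_nondegenerate_at (encoding_map \<phi> \<beta>) x) \<and>
      (\<exists>W. open W \<and> K \<subseteq> W \<and> compact (closure W) \<and> closure W \<subseteq> U \<and>
         (\<forall>\<beta>\<in>V. critical_hypersurface_tangential_immersion_on (encoding_map \<phi> \<beta>) W))"
proof -
  let ?E = "encoding_map \<phi>"
  let ?P = "param_power A :: (real ^ 'm ^ 'd) set"
  obtain f' where f': "\<And>z. z \<in> A \<times> UNIV \<Longrightarrow>
        ((\<lambda>(\<alpha>, x). \<phi> \<alpha> x) has_derivative blinfun_apply (f' z)) (at z)"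
    and C1: "C1_on f' (A \<times> UNIV)"
    using assms(3) unfolding C2_on_def by blast
  have memA: "\<beta> $ i \<in> A" if "\<beta> \<in> ?P" for \<beta> i
    using that by (auto simp: param_power_def)
  \<comment> \<open>The Jacobian matrix as a function of parameter and point jointly, read off from
    the partial derivatives in \<open>x\<close>; the identification \<open>jac\<close> holds for
    parameters in \<open>?P\<close>.\<close>
  define B where "B z = (\<chi> i j. f' (fst z $ i, snd z) (0, axis j 1))"
    for z :: "(real ^ 'm ^ 'd) \<times> (real ^ 'd)"
  define J where "J z = det (B z)" for z
  have "C1_on (\<lambda>z. blinfun_apply (f' (fst z $ i, snd z)) (0, axis j 1)) (?P \<times> UNIV)" for i j
    by (rule C1_on_compose_bounded_linear[OF C1, where g = "\<lambda>z. (fst z $ i, snd z)"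
          and h = "\<lambda>b. blinfun_apply b (0, axis j 1)"])
       (auto intro!: bounded_linear_intros memA
          bounded_linear_compose[OF bounded_linear_vec_nth bounded_linear_fst])
  then have C1_B: "C1_on (\<lambda>z. B z $ i $ j) (?P \<times> UNIV)" for i j
    by (simp add: B_def)
  then have contB: "continuous_on (?P \<times> UNIV) B"
    by (subst continuous_on_componentwise, subst continuous_on_componentwise)
       (auto simp: Basis_vec_def inner_axis intro: C1_on_imp_continuous_on)
  \<comment> \<open>Here the joint C^2 hypothesis pays off: the derivative of the determinant is
    continuous in the parameter as well as in the point.\<close>
  have "C1_on J (?P \<times> UNIV)"
    unfolding J_def by (rule C1_on_det[OF C1_B])
  then obtain DJ where DJ: "\<And>z. z \<in> ?P \<times> UNIV \<Longrightarrow> (J has_derivative blinfun_apply (DJ z)) (at z)"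
    and contDJ: "continuous_on (?P \<times> UNIV) DJ"
    unfolding C1_on_def by blast
  have jac: "jacobian (?E \<beta>) (at x) = B (\<beta>, x)" if "\<beta> \<in> ?P" for \<beta> x
    unfolding jacobian_def
    by (simp add: matrix_def B_def
        frechet_derivative_at[OF has_derivative_encoding_map[OF f' that], symmetric])
  have J: "jac_det (?E \<beta>) = (\<lambda>x. J (\<beta>, x))" if "\<beta> \<in> ?P" for \<beta>
    by (auto simp: jac_det_def jac[OF that] J_def)
  have derJ: "(jac_det (?E \<beta>) has_derivative (\<lambda>v. DJ (\<beta>, x) (0, v))) (at x)"
    if "\<beta> \<in> ?P" for \<beta> x
    unfolding J[OF that]
    using that by (intro has_derivative_compose[OF
        has_derivative_Pair[OF has_derivative_const has_derivative_ident] DJ]) simp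
  have C1_J: "C1_on (jac_det (?E \<beta>)) W" if "\<beta> \<in> ?P" for \<beta> W
    unfolding C1_on_iff
    using derJ[OF that] that
    by (intro exI[of _ "\<lambda>x v. DJ (\<beta>, x) (0, v)"])
       (auto intro!: continuous_intros continuous_on_compose2[OF contDJ])
  \<comment> \<open>A sum of nonnegative terms, zero exactly when \<open>v\<close> lies in both
    kernels.\<close>
  define G where "G = (\<lambda>(\<beta>, x, v). norm (B (\<beta>, x) *v v) + \<bar>DJ (\<beta>, x) (0, v)\<bar>)"
  have fold: "fold_nondegenerate_at (?E \<beta>) x \<longleftrightarrow> (\<forall>v\<in>sphere 0 1. G (\<beta>, x, v) \<noteq> 0)"
    if "\<beta> \<in> ?P" "x \<in> critical_points (?E \<beta>)" for \<beta> x
    unfolding fold_nondegenerate_iff[OF derJ[OF that(1)] that(2)] jac[OF that(1)] G_def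
    by (simp add: add_nonneg_eq_0_iff)
  have "continuous_on (?P \<times> UNIV) G"
    unfolding G_def case_prod_unfold matrix_vector_mult_def
    by (intro continuous_intros continuous_on_compose2[OF contDJ] continuous_on_vec_lambda
        continuous_on_compose2[OF contB]) auto
  moreover have "open (?P \<times> (UNIV :: ((real ^ 'd) \<times> (real ^ 'd)) set))"
    by (intro open_Times open_param_power assms open_UNIV)
  ultimately have opn: "open ((?P \<times> UNIV) \<inter> G -` (- {0}))"
    by (intro continuous_open_preimage) auto
  \<comment> \<open>\<open>W\<close> is fixed before the parameter neighbourhood: with the compact
    set \<open>closure W\<close> between \<open>K\<close> and \<open>U\<close>, one application of
    the tube lemma serves both claims.\<close>
  obtain e where e: "e > 0" "(\<Union>x\<in>K. cball x e) \<subseteq> U"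
    using compact_subset_open_imp_cball_epsilon_subset[OF assms(4-6)] by blast
  define W where "W = (\<Union>x\<in>K. ball x e)"
  have "open W" "K \<subseteq> W" using e by (auto simp: W_def)
  have clW: "closure W \<subseteq> (\<Union>x\<in>K. cball x e)"
  proof (rule closure_minimal)
    show "closed (\<Union>x\<in>K. cball x e)"
      using compact_minkowski_sum_cball[OF assms(4)] compact_imp_closed by blast
  qed (auto simp: W_def)
  have "bounded (\<Union>x\<in>K. cball x e)"
    using compact_minkowski_sum_cball[OF assms(4)] compact_imp_bounded by blast
  then have cpt: "compact (closure W)"
    using clW bounded_subset by (auto simp: compact_eq_bounded_closed)
  \<comment> \<open>At critical points this is the hypothesis on \<open>closure U\<close>; elsewhere
    the Jacobian matrix is invertible, so the first term of \<open>G\<close> is already nonzero on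
    unit vectors.\<close>
  have "{\<alpha>0} \<times> (closure W \<times> sphere 0 1) \<subseteq> (?P \<times> UNIV) \<inter> G -` (- {0})"
  proof -
    have "G (\<alpha>0, x, v) \<noteq> 0" if x: "x \<in> closure W" and v: "v \<in> sphere 0 1" for x v
    proof (cases "x \<in> critical_points (?E \<alpha>0)")
      case True
      moreover have "x \<in> closure U"
        using x clW e(2) closure_subset by blast
      ultimately show ?thesis
        using assms(8) fold[OF assms(7) True] v by blast
    next
      case False
      then have "det (B (\<alpha>0, x)) \<noteq> 0"
        by (simp add: critical_points_iff J[OF assms(7)] J_def)
      moreover have "v \<noteq> 0"
        using v by auto
      ultimately have "B (\<alpha>0, x) *v v \<noteq> 0"
        using matrix_nonfull_linear_equations_eq[of "B (\<alpha>0, x)"] rank_bound[of "B (\<alpha>0, x)"]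
        by (auto simp: det_eq_0_rank)
      then show ?thesis
        unfolding G_def by (simp add: add_nonneg_eq_0_iff)
    qed
    then show ?thesis using assms(7) by auto
  qed
  from Elementary_Topology.tube_lemma[OF compact_Times[OF cpt compact_sphere] opn this]
  obtain V where V: "\<alpha>0 \<in> V" "open V"
    "V \<times> (closure W \<times> sphere 0 1) \<subseteq> (?P \<times> UNIV) \<inter> G -` (- {0})"
    by (elim exE conjE)
  have stable: "fold_nondegenerate_at (?E \<beta>) x"
    if "\<beta> \<in> V \<inter> ?P" "x \<in> critical_points (?E \<beta>) \<inter> closure W" for \<beta> x
    using that fold[of \<beta> x] V(3) by blast
  show ?thesis
  \<comment> \<open>The intersection with \<open>?P\<close> covers empty \<open>K\<close>: then the
    compact fibre is empty and the tube lemma does not confine \<open>V\<close>.\<close>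
  proof (intro exI[of _ "V \<inter> ?P"] exI[of _ W] conjI ballI)
    show "open (V \<inter> ?P)" using V open_param_power[OF assms(2)] by auto
    show "fold_nondegenerate_at (?E \<beta>) x"
      if "\<beta> \<in> V \<inter> ?P" "x \<in> critical_points (?E \<beta>) \<inter> K" for \<beta> x
      using that stable closure_subset \<open>K \<subseteq> W\<close> by blast
    show "critical_hypersurface_tangential_immersion_on (?E \<beta>) W" if "\<beta> \<in> V \<inter> ?P" for \<beta>
    proof (rule fold_imp_critical_hypersurface[OF assms(1) \<open>open W\<close> C1_J])
      show "fold_nondegenerate_at (?E \<beta>) x" if "x \<in> critical_points (?E \<beta>) \<inter> W" for x
        using that stable[OF \<open>\<beta> \<in> V \<inter> ?P\<close>] closure_subset by blast
    qed (use that in simp)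
  qed (use V assms(7) cpt clW e(2) \<open>open W\<close> \<open>K \<subseteq> W\<close> in auto)
qed

end
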